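(* Let $q$ be a complex polynomial on $\mathbb{C}^n$ that does not vanish on the closed unit ball, and let $S(q)\subset\mathbb{C}^n$ denote the finite set, determined by $q$, that is defined in the context. If $f=\frac{p}{q}$ is a rational proper holomorphic mapping from $B_n$ to $B_N$ that is reduced to lowest terms, then $f^{-1}(0)\subset S(q)$. In particular, if $q=1$ then $S(q)=\{0\}$. Thus, if $p$ is a proper polynomial map between balls, then either $p^{-1}(0)$ is empty or $p^{-1}(0)=\{0\}$.
   Context: $B_n$ is the open unit ball in $\mathbb{C}^n$; $\langle w,z\rangle=\sum_j w_j\overline{z_j}$. Here $p:\mathbb{C}^n\to\mathbb{C}^N$ is a polynomial map, and inverse images are taken in the domain ball. Given a polynomial $q$ not vanishing on the closed unit ball, write its degree as $d-1$ and let $q=\sum_{j=0}^{d-1}q_j$ be its expansion into homogeneous parts ($q_j$ homogeneous of degree $j$). Define $$Hq(w,z)=\sum_{j=0}^{d-1}\langle w,z\rangle^{d-j}q_j(w),$$ which is homogeneous of degree $d$ in $w$. Then $S(q)$ is the set of $z\in\mathbb{C}^n$ for which the polynomial $w\mapsto Hq(w,z)$ vanishes identically; this set is finite. *)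

theory Defs
  imports "HOL-Analysis.Analysis" "HOL-Library.Poly_Mapping"
begin

text \<open>
  Complex polynomials in the variables indexed by a finite type \<open>'n\<close>: finitely supported maps
  from exponent vectors to coefficients, with convolution as multiplication, so that
  divisibility is the library relation \<open>dvd\<close> of this commutative ring.
\<close>

type_synonym 'n cpoly = "('n \<Rightarrow>\<^sub>0 nat) \<Rightarrow>\<^sub>0 complex"

definition monom_degree :: "('n::finite \<Rightarrow>\<^sub>0 nat) \<Rightarrow> nat" where
  "monom_degree m = (\<Sum>i\<in>UNIV. Poly_Mapping.lookup m i)"

definition peval :: "('n::finite) cpoly \<Rightarrow> complex ^ 'n \<Rightarrow> complex" where
  "peval q z = (\<Sum>m\<in>Poly_Mapping.keys q.
     Poly_Mapping.lookup q m * (\<Prod>i\<in>UNIV. (z $ i) ^ Poly_Mapping.lookup m i))"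

text \<open>The zero polynomial gets degree 0.\<close>

definition total_degree :: "('n::finite) cpoly \<Rightarrow> nat" where
  "total_degree q = Max (insert 0 (monom_degree ` Poly_Mapping.keys q))"

definition homogeneous_part :: "nat \<Rightarrow> ('n::finite) cpoly \<Rightarrow> 'n cpoly" where
  "homogeneous_part j q =
     (\<Sum>m\<in>{m \<in> Poly_Mapping.keys q. monom_degree m = j}.
       Poly_Mapping.single m (Poly_Mapping.lookup q m))"

text \<open>The inner product of the library on \<open>complex ^ 'n\<close> is the real part of this one.\<close>

definition hermitian :: "complex ^ 'n \<Rightarrow> complex ^ 'n \<Rightarrow> complex" where
  "hermitian w z = (\<Sum>j\<in>UNIV. w $ j * cnj (z $ j))"

definition Hq :: "('n::finite) cpoly \<Rightarrow> complex ^ 'n \<Rightarrow> complex ^ 'n \<Rightarrow> complex" where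
  "Hq q w z = (let d = total_degree q + 1 in
     \<Sum>j = 0..d - 1. hermitian w z ^ (d - j) * peval (homogeneous_part j q) w)"

definition S_set :: "('n::finite) cpoly \<Rightarrow> (complex ^ 'n) set" where
  "S_set q = {z. \<forall>w. Hq q w z = 0}"

definition poly_map :: "('n::finite) cpoly ^ 'm \<Rightarrow> complex ^ 'n \<Rightarrow> complex ^ 'm" where
  "poly_map p z = (\<chi> i. peval (p $ i) z)"

definition rat_map :: "('n::finite) cpoly ^ 'm \<Rightarrow> 'n cpoly \<Rightarrow> complex ^ 'n \<Rightarrow> complex ^ 'm" where
  "rat_map p q z = (\<chi> i. peval (p $ i) z / peval q z)"

definition lowest_terms :: "('n::finite) cpoly ^ 'm \<Rightarrow> 'n cpoly \<Rightarrow> bool" where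
  "lowest_terms p q \<longleftrightarrow> (\<forall>g. g dvd q \<and> (\<forall>i. g dvd p $ i) \<longrightarrow> g dvd 1)"

text \<open>Holomorphy in several variables: the real Frechet derivative exists and is complex linear.\<close>

definition holomorphic_map_on ::
    "(complex ^ 'n \<Rightarrow> complex ^ 'm) \<Rightarrow> (complex ^ 'n) set \<Rightarrow> bool" where
  "holomorphic_map_on f U \<longleftrightarrow>
     (\<forall>z\<in>U. \<exists>D. (f has_derivative D) (at z) \<and> (\<forall>c v. D (c *s v) = c *s D v))"

text \<open>
  The norm on \<open>complex ^ 'n\<close> is the Euclidean one, so \<open>ball 0 1\<close> is the open unit ball
  in dimension \<open>CARD('n)\<close>. Being a \<open>proper_map\<close> includes mapping the one ball into the other.
\<close>

definition proper_ball_map :: "(complex ^ 'n \<Rightarrow> complex ^ 'm) \<Rightarrow> bool" where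
  "proper_ball_map f \<longleftrightarrow>
     continuous_on (ball 0 1) f \<and> proper_map (top_of_set (ball 0 1)) (top_of_set (ball 0 1)) f"

end

theory Submission
  imports Defs "HOL-Complex_Analysis.Conformal_Mappings"
begin

text \<open>
  The heart of the matter is that an identity between polynomials which holds on the unit sphere
  can be polarized. Since \<open>q\<close> has no zero on the closed ball, \<open>f = p / q\<close> is continuous there, and
  a proper \<open>f\<close> must map the sphere to the sphere, so \<open>\<parallel>p(z)\<parallel> = \<bar>q(z)\<bar>\<close> whenever \<open>\<parallel>z\<parallel> = 1\<close> (\<open>proper_norm_eq_on_sphere\<close>).
  In the coordinates \<open>(w, cnj z)\<close>, the equation \<open>\<langle>w, z\<rangle> = 1\<close> defines a complex quadric, in which the
  sphere is the diagonal \<open>w = z\<close>, a totally real subset large enough to force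
  \<open>\<langle>p(w), p(z)\<rangle> = q(w) \<cdot> cnj (q(z))\<close> on the whole quadric (\<open>sphere_identity_polarized\<close>).

  Let \<open>f(a) = 0\<close> with \<open>\<parallel>a\<parallel> < 1\<close>. Putting \<open>z = a\<close> makes the left side vanish, while \<open>q(a) \<noteq> 0\<close>, so
  \<open>q\<close> vanishes on the affine hyperplane \<open>\<langle>w, a\<rangle> = 1\<close>. Now \<open>Hq\<close> is a homogenization:
  \<open>Hq(w, a) = \<langle>w, a\<rangle>\<^sup>d q(w / \<langle>w, a\<rangle>)\<close> where \<open>\<langle>w, a\<rangle> \<noteq> 0\<close>, and all its terms contain a factor \<open>\<langle>w, a\<rangle>\<close>.
  Hence membership in \<open>S(q)\<close> says precisely that \<open>q\<close> vanishes on this hyperplane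
  (\<open>S_set_iff_hyperplane\<close>), and \<open>a \<in> S(q)\<close> follows.

  Finiteness of \<open>S(q)\<close> comes from evaluating at the basis vectors: \<open>Hq(e\<^sub>i, z)\<close> is a one-variable
  polynomial in \<open>cnj z\<^sub>i\<close> whose leading coefficient is \<open>q(0) \<noteq> 0\<close>, which leaves finitely many
  possibilities for each coordinate of \<open>z\<close>.
\<close>

section \<open>Evaluation and homogeneous parts\<close>

lemma lookup_homogeneous_part:
  "Poly_Mapping.lookup (homogeneous_part j q) m =
     (if monom_degree m = j then Poly_Mapping.lookup q m else 0)"
proof -
  have "Poly_Mapping.lookup (homogeneous_part j q) m =
        (\<Sum>m'\<in>{m \<in> Poly_Mapping.keys q. monom_degree m = j}.
           if m' = m then Poly_Mapping.lookup q m' else 0)"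
    unfolding homogeneous_part_def
    by (simp add: lookup_sum lookup_single when_def)
  also have "\<dots> = (if monom_degree m = j then Poly_Mapping.lookup q m else 0)"
    by (subst sum.delta) (auto simp: in_keys_iff)
  finally show ?thesis .
qed

lemma keys_homogeneous_part:
  "Poly_Mapping.keys (homogeneous_part j q) =
     {m \<in> Poly_Mapping.keys q. monom_degree m = j}"
  by (auto simp: in_keys_iff lookup_homogeneous_part split: if_splits)

lemma peval_homogeneous_part:
  "peval (homogeneous_part j q) z =
     (\<Sum>m | m \<in> Poly_Mapping.keys q \<and> monom_degree m = j.
        Poly_Mapping.lookup q m * (\<Prod>i\<in>UNIV. (z $ i) ^ Poly_Mapping.lookup m i))"
  unfolding peval_def keys_homogeneous_part
  by (rule sum.cong) (auto simp: lookup_homogeneous_part)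

lemma monom_degree_le_total_degree:
  "m \<in> Poly_Mapping.keys q \<Longrightarrow> monom_degree m \<le> total_degree q"
  unfolding total_degree_def by (intro Max_ge) auto

lemma peval_scale:
  "peval q (c *s w) = (\<Sum>j=0..total_degree q. c ^ j * peval (homogeneous_part j q) w)"
proof -
  define t where "t = (\<lambda>m. Poly_Mapping.lookup q m *
    (\<Prod>i\<in>UNIV. (w $ i) ^ Poly_Mapping.lookup m i))"
  have "peval q (c *s w) = (\<Sum>m\<in>Poly_Mapping.keys q. c ^ monom_degree m * t m)"
    unfolding peval_def t_def monom_degree_def
    by (intro sum.cong) (simp_all add: power_mult_distrib prod.distrib power_sum mult_ac)
  also have "\<dots> = (\<Sum>j=0..total_degree q.
      \<Sum>m | m \<in> Poly_Mapping.keys q \<and> monom_degree m = j. c ^ monom_degree m * t m)"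
    by (rule sum.group[symmetric]) (auto intro: monom_degree_le_total_degree)
  also have "\<dots> = (\<Sum>j=0..total_degree q. c ^ j * peval (homogeneous_part j q) w)"
    by (intro sum.cong) (auto simp: peval_homogeneous_part t_def sum_distrib_left)
  finally show ?thesis .
qed

lemma peval_homogeneous_part_0: "peval (homogeneous_part 0 q) w = peval q 0"
proof -
  have "peval q 0 = peval q (0 *s w)" by simp
  also have "\<dots> = (\<Sum>j=0..total_degree q. 0 ^ j * peval (homogeneous_part j q) w)"
    by (rule peval_scale)
  also have "\<dots> = (\<Sum>j=0..total_degree q. if j = 0 then peval (homogeneous_part 0 q) w else 0)"
    by (intro sum.cong) auto
  finally show ?thesis by simp
qed

lemma peval_1 [simp]: "peval 1 z = 1"
  by (simp add: peval_def lookup_one)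

lemma continuous_on_peval [continuous_intros]:
  "continuous_on A f \<Longrightarrow> continuous_on A (\<lambda>x. peval q (f x))"
  unfolding peval_def by (intro continuous_intros)

lemma holomorphic_on_peval:
  assumes "\<And>i. (\<lambda>t. f t $ i) holomorphic_on A"
  shows "(\<lambda>t. peval q (f t)) holomorphic_on A"
  unfolding peval_def by (intro holomorphic_intros assms)

section \<open>\<open>S(q)\<close> as a set of hyperplanes\<close>

lemma hermitian_scale_left: "hermitian (c *s w) z = c * hermitian w z"
  by (simp add: hermitian_def sum_distrib_left mult.assoc)

lemma hermitian_axis: "hermitian (axis i 1) z = cnj (z $ i)"
  by (simp add: hermitian_def axis_def if_distrib if_distribR cong: if_cong)

lemma Hq_eq_homogenization:
  assumes "hermitian w z \<noteq> 0"
  shows "Hq q w z =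
    hermitian w z ^ (total_degree q + 1) * peval q (inverse (hermitian w z) *s w)"
  unfolding Hq_def Let_def peval_scale sum_distrib_left
  using assms by (intro sum.cong) (auto simp: power_diff field_simps)

lemma Hq_eq_0_if_orthogonal: "hermitian w z = 0 \<Longrightarrow> Hq q w z = 0"
  unfolding Hq_def Let_def by (intro sum.neutral) auto

text \<open>
  If \<open>\<langle>w, z\<rangle> \<noteq> 0\<close>, a multiple of \<open>w\<close> lies on the hyperplane, and \<open>Hq\<close> is homogeneous in \<open>w\<close>. For
  \<open>z = 0\<close> the hyperplane is empty; thus \<open>S(q)\<close> always contains the origin.
\<close>

lemma S_set_iff_hyperplane:
  "z \<in> S_set q \<longleftrightarrow> (\<forall>w. hermitian w z = 1 \<longrightarrow> peval q w = 0)"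
proof
  assume z: "z \<in> S_set q"
  show "\<forall>w. hermitian w z = 1 \<longrightarrow> peval q w = 0"
  proof (intro allI impI)
    fix w assume "hermitian w z = 1"
    with z Hq_eq_homogenization[of w z q] show "peval q w = 0"
      by (simp add: S_set_def)
  qed
next
  assume vanish: "\<forall>w. hermitian w z = 1 \<longrightarrow> peval q w = 0"
  have "Hq q w z = 0" for w
  proof (cases "hermitian w z = 0")
    case False
    with vanish have "peval q (inverse (hermitian w z) *s w) = 0"
      by (simp add: hermitian_scale_left)
    with False show ?thesis by (simp add: Hq_eq_homogenization)
  qed (rule Hq_eq_0_if_orthogonal)
  then show "z \<in> S_set q" by (simp add: S_set_def)
qed

lemma finite_vec_components:
  fixes A :: "'n::finite \<Rightarrow> 'a set"
  assumes "\<And>i. finite (A i)"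
  shows "finite {v :: 'a ^ 'n. \<forall>i. v $ i \<in> A i}"
proof (rule finite_subset)
  show "{v :: 'a ^ 'n. \<forall>i. v $ i \<in> A i} \<subseteq> vec_lambda ` PiE UNIV A"
  proof
    fix v :: "'a ^ 'n" assume "v \<in> {v. \<forall>i. v $ i \<in> A i}"
    then have "v = vec_lambda (vec_nth v)" "vec_nth v \<in> PiE UNIV A" by auto
    then show "v \<in> vec_lambda ` PiE UNIV A" by blast
  qed
  show "finite (vec_lambda ` PiE UNIV A :: ('a ^ 'n) set)"
    using assms by (intro finite_imageI finite_PiE) auto
qed

text \<open>
  The polynomial \<open>P i\<close> has \<open>cnj (z $ i)\<close> among its roots for every \<open>z \<in> S(q)\<close>. Its coefficient of
  degree \<open>d\<close> is the constant term of \<open>q\<close>, so there are only finitely many roots.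
\<close>

lemma finite_S_set:
  fixes q :: "('n::finite) cpoly"
  assumes "peval q 0 \<noteq> 0"
  shows "finite (S_set q)"
proof -
  define d where "d = total_degree q + 1"
  define P where "P = (\<lambda>i :: 'n.
    \<Sum>j=0..d - 1. Polynomial.monom (peval (homogeneous_part j q) (axis i 1)) (d - j))"
  have poly_P: "poly (P i) (cnj (z $ i)) = Hq q (axis i 1) z" for i z
    by (simp add: P_def Hq_def d_def poly_sum poly_monom hermitian_axis mult.commute)
  have "P i \<noteq> 0" for i
  proof -
    have "coeff (P i) d =
        (\<Sum>j=0..d - 1. if j = 0 then peval (homogeneous_part 0 q) (axis i 1) else 0)"
      unfolding P_def coeff_sum by (intro sum.cong) (auto simp: d_def)
    also have "\<dots> = peval q 0" by (simp add: peval_homogeneous_part_0)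
    finally show ?thesis using assms by auto
  qed
  then have "finite (cnj ` {x. poly (P i) x = 0})" for i
    by (intro finite_imageI poly_roots_finite)
  then have "finite {z :: complex ^ 'n. \<forall>i. z $ i \<in> cnj ` {x. poly (P i) x = 0}}"
    by (rule finite_vec_components)
  moreover have "S_set q \<subseteq> {z. \<forall>i. z $ i \<in> cnj ` {x. poly (P i) x = 0}}"
  proof clarify
    fix z i assume "z \<in> S_set q"
    then have "cnj (z $ i) \<in> {x. poly (P i) x = 0}"
      by (simp add: poly_P S_set_def)
    then show "z $ i \<in> cnj ` {x. poly (P i) x = 0}"
      by (metis complex_cnj_cnj image_eqI)
  qed
  ultimately show ?thesis by (rule rev_finite_subset)
qed

lemma S_set_1: "S_set (1 :: ('n::finite) cpoly) = {0}"
proof (intro set_eqI iffI)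
  fix z :: "complex ^ 'n" assume "z \<in> S_set 1"
  then have no_w: "hermitian w z \<noteq> 1" for w by (auto simp: S_set_iff_hyperplane)
  have "z $ i = 0" for i
  proof (rule ccontr)
    assume "z $ i \<noteq> 0"
    then have "hermitian (inverse (cnj (z $ i)) *s axis i 1) z = 1"
      by (simp add: hermitian_scale_left hermitian_axis)
    with no_w show False by blast
  qed
  then show "z \<in> {0}" by (simp add: vec_eq_iff)
qed (simp add: S_set_iff_hyperplane hermitian_def)

section \<open>Polarization on the unit sphere\<close>

lemma Re_hermitian: "Re (hermitian w z) = inner w z"
  by (simp add: hermitian_def inner_vec_def inner_complex_def)

lemma hermitian_self: "hermitian z z = of_real ((norm z)\<^sup>2)"
  by (simp add: hermitian_def norm_vec_def L2_set_def sum_nonneg complex_norm_square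
      del: of_real_power)

lemma norm_complex_scale: "norm (c *s x) = cmod c * norm (x :: complex ^ 'n)"
  by (simp add: norm_vec_def norm_mult L2_set_right_distrib)

lemma of_real_scale: "of_real r *s x = r *\<^sub>R (x :: complex ^ 'n)"
  by (simp add: vec_eq_iff scaleR_conv_of_real[where 'a=complex])

lemma hermitian_commute: "hermitian z w = cnj (hermitian w z)"
  by (simp add: hermitian_def mult.commute)

lemma norm_cos_sin_orthonormal:
  fixes u v :: "'a::real_inner"
  assumes "norm u = 1" "norm v = 1" "inner u v = 0"
  shows "norm (cos t *\<^sub>R u + sin t *\<^sub>R v) = 1"
proof -
  have "(norm (cos t *\<^sub>R u + sin t *\<^sub>R v))\<^sup>2 = (cos t)\<^sup>2 * (norm u)\<^sup>2 + (sin t)\<^sup>2 * (norm v)\<^sup>2"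
    unfolding power2_norm_eq_inner using assms(3)
    by (simp add: inner_add_left inner_add_right inner_commute[of v u] power2_eq_square)
  then show ?thesis using assms by (intro power2_eq_imp_eq[of _ 1]) simp_all
qed

lemma cosh_of_real: "cosh (complex_of_real s) = of_real (cosh s)"
  by (simp add: cosh_field_def exp_minus exp_of_real)

lemma sinh_of_real: "sinh (complex_of_real s) = of_real (sinh s)"
  by (simp add: sinh_field_def exp_minus exp_of_real)

lemma entire_zero_on_reals:
  assumes "G holomorphic_on UNIV" and "\<And>t :: real. G (of_real t) = 0"
  shows "G z = 0"
proof (rule analytic_continuation[of G UNIV "range of_real" 0])
  show "(0 :: complex) islimpt range of_real"
    unfolding islimpt_approachable
  proof (intro allI impI)
    fix e :: real assume "0 < e"
    then show "\<exists>x'\<in>range of_real. x' \<noteq> (0::complex) \<and> dist x' 0 < e"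
      by (intro bexI[OF _ rangeI[of _ "e / 2"]]) auto
  qed
qed (use assms in auto)

text \<open>
  A point \<open>(w, z)\<close> of the quadric off the diagonal can be written \<open>w = A + \<i>B\<close>, \<open>z = A - \<i>B\<close>. The
  condition \<open>\<langle>w, z\<rangle> = 1\<close> then says that \<open>A\<close> and \<open>B\<close> are orthogonal as real vectors and that
  \<open>\<parallel>A\<parallel>\<^sup>2 - \<parallel>B\<parallel>\<^sup>2 = 1\<close>, so \<open>\<parallel>A\<parallel> = cosh s\<close> and \<open>\<parallel>B\<parallel> = sinh s\<close> for some real \<open>s\<close>. The directions of
  \<open>A\<close> and \<open>B\<close> span a great circle \<open>\<gamma>\<close> of the sphere. Its parametrization by cosine and sine extends
  to complex arguments, and \<open>t \<mapsto> (\<gamma> t, \<gamma> (cnj t))\<close> is a holomorphic curve in the quadric, up to the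
  conjugation of the second component. It joins the sphere (\<open>t\<close> real) to the
  point \<open>(w, z)\<close> (\<open>t = \<i>s\<close>), so the identity theorem carries the given equation along it.
\<close>

lemma sphere_identity_polarized:
  fixes p :: "('n::finite) cpoly ^ ('m::finite)"
  assumes sphere: "\<And>x. norm x = 1 \<Longrightarrow> norm (poly_map p x) = cmod (peval q x)"
    and wz: "hermitian w z = 1"
  shows "hermitian (poly_map p w) (poly_map p z) = peval q w * cnj (peval q z)"
proof (cases "w = z")
  case True
  with wz have "norm z = 1"
    by (metis hermitian_self norm_ge_zero of_real_eq_1_iff power2_eq_1_iff
        le_minus_one_simps(3) not_le)
  with sphere[of z] True show ?thesis
    by (simp add: hermitian_self complex_norm_square del: of_real_power)
next
  case False
  define A where "A = (1 / 2) *s (w + z)"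
  define B where "B = (- \<i> / 2) *s (w - z)"
  have w_eq: "w = A + \<i> *s B" and z_eq: "z = A - \<i> *s B"
    by (simp_all add: A_def B_def vec_eq_iff field_simps)
  have "hermitian w z = hermitian A A - hermitian B B + \<i> * (hermitian A B + hermitian B A)"
  proof -
    have "hermitian w z = (\<Sum>j\<in>UNIV. A $ j * cnj (A $ j) - B $ j * cnj (B $ j)
        + \<i> * (A $ j * cnj (B $ j) + B $ j * cnj (A $ j)))"
      unfolding hermitian_def by (subst w_eq, subst z_eq) (simp add: algebra_simps)
    then show ?thesis
      by (simp add: hermitian_def sum.distrib sum_subtractf flip: sum_distrib_left)
  qed
  also have "\<dots> = of_real ((norm A)\<^sup>2 - (norm B)\<^sup>2) + \<i> * of_real (2 * inner A B)"
    by (simp add: hermitian_commute[of B A] hermitian_self complex_add_cnj Re_hermitian)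
  finally have "(norm A)\<^sup>2 - (norm B)\<^sup>2 = 1" and orth: "inner A B = 0"
    using wz by (simp_all add: complex_eq_iff)
  then have norm_A: "(norm A)\<^sup>2 = (norm B)\<^sup>2 + 1" by simp
  then have "A \<noteq> 0" by (auto simp: add_nonneg_eq_0_iff)
  from False have "B \<noteq> 0" by (auto simp: w_eq z_eq)
  define u where "u = A /\<^sub>R norm A"
  define v where "v = B /\<^sub>R norm B"
  have uv: "norm u = 1" "norm v = 1" "inner u v = 0"
    using \<open>A \<noteq> 0\<close> \<open>B \<noteq> 0\<close> orth by (simp_all add: u_def v_def)
  \<comment> \<open>A great circle for real arguments; at the imaginary arguments \<open>\<plusminus>\<i>s\<close> it passes through
    \<open>w\<close> and \<open>z\<close>.\<close>
  define \<gamma> where "\<gamma> = (\<lambda>t. cos t *s u + sin t *s v)"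
  have \<gamma>_real: "norm (\<gamma> (of_real t)) = 1" for t
  proof -
    have "\<gamma> (of_real t) = cos t *\<^sub>R u + sin t *\<^sub>R v"
      by (simp add: \<gamma>_def cos_of_real sin_of_real of_real_scale)
    then show ?thesis using norm_cos_sin_orthonormal[OF uv] by simp
  qed
  define s where "s = arsinh (norm B)"
  have sinh_s: "sinh s = norm B" by (simp add: s_def)
  have cosh_s: "cosh s = norm A"
    by (rule power2_eq_imp_eq) (simp_all add: cosh_square_eq sinh_s norm_A)
  have cos_s: "cos (\<i> * of_real s) = of_real (norm A)"
    by (simp only: cosh_of_real cosh_s flip: cosh_conv_cos)
  have "of_real (norm B) = - \<i> * sin (\<i> * of_real s)"
    using sinh_conv_sin[of "of_real s"] by (simp only: sinh_of_real sinh_s)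
  then have sin_s: "sin (\<i> * of_real s) = \<i> * of_real (norm B)" by simp
  have A: "of_real (norm A) *s u = A" and B: "of_real (norm B) *s v = B"
    using \<open>A \<noteq> 0\<close> \<open>B \<noteq> 0\<close> by (simp_all add: u_def v_def of_real_scale)
  have iB: "(\<i> * of_real (norm B)) *s v = \<i> *s B"
    using vector_smult_assoc[of \<i> "of_real (norm B)" v] by (simp only: B)
  have w: "\<gamma> (\<i> * of_real s) = w"
    by (simp only: \<gamma>_def w_eq cos_s sin_s A iB)
  have z: "\<gamma> (cnj (\<i> * of_real s)) = z"
  proof -
    have cnj_is: "cnj (\<i> * of_real s) = - (\<i> * of_real s)" by simp
    show ?thesis
      by (simp only: \<gamma>_def z_eq cnj_is cos_minus sin_minus cos_s sin_s vector_smult_lneg A iB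
          diff_conv_add_uminus)
  qed
  define G where "G = (\<lambda>t.
    (\<Sum>i\<in>UNIV. peval (p $ i) (\<gamma> t) * cnj (peval (p $ i) (\<gamma> (cnj t))))
      - peval q (\<gamma> t) * cnj (peval q (\<gamma> (cnj t))))"
  have "G (\<i> * of_real s) = 0"
  proof (rule entire_zero_on_reals[of G])
    have hol: "(\<lambda>t. peval r (\<gamma> t)) holomorphic_on UNIV" for r
      by (intro holomorphic_on_peval) (auto simp: \<gamma>_def intro!: holomorphic_intros)
    have "(\<lambda>t. cnj (peval r (\<gamma> (cnj t)))) holomorphic_on UNIV" for r
      using holomorphic_on_compose_cnj_cnj[OF holomorphic_on_subset[OF hol[of r]], of UNIV]
      by (simp add: o_def)
    with hol show "G holomorphic_on UNIV"
      unfolding G_def by (intro holomorphic_intros)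
    fix t :: real
    let ?x = "\<gamma> (of_real t)"
    have "G (of_real t) = hermitian (poly_map p ?x) (poly_map p ?x)
        - peval q ?x * cnj (peval q ?x)"
      by (simp add: G_def hermitian_def poly_map_def)
    also have "\<dots> = 0"
      by (simp add: hermitian_self sphere[OF \<gamma>_real] complex_norm_square del: of_real_power)
    finally show "G (of_real t) = 0" .
  qed
  then show ?thesis
    unfolding G_def w z by (simp add: hermitian_def poly_map_def)
qed

section \<open>Zeros of proper maps\<close>

text \<open>
  If \<open>f(z)\<close> were an interior point, then a closed ball of radius \<open>r < 1\<close> would contain the values of
  \<open>f\<close> near \<open>z\<close>; but its preimage is a compact subset of the open ball and stays away from \<open>z\<close>.
\<close>

lemma proper_norm_eq_on_sphere:
  assumes cont: "continuous_on (cball 0 1) f"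
    and proper: "proper_ball_map f" and z: "norm z = 1"
  shows "norm (f z) = 1"
proof -
  have ball: "f x \<in> ball 0 1" if "x \<in> ball 0 1" for x
    using proper_map_imp_subset_topspace[of "top_of_set (ball 0 1)" "top_of_set (ball 0 1)" f]
      proper that by (auto simp: proper_ball_map_def)
  have closure: "closure (ball (0 :: complex ^ 'n) 1) = cball 0 1" by simp
  have "f ` closure (ball 0 1) \<subseteq> cball 0 1"
    using cont ball by (intro image_closure_subset) (auto simp: less_imp_le)
  then have "norm (f z) \<le> 1" using z by (simp add: closure image_subset_iff)
  moreover have "\<not> norm (f z) < 1"
  proof
    assume "norm (f z) < 1"
    then obtain r where r: "norm (f z) < r" "r < 1" using dense by blast
    define C where "C = {x \<in> ball 0 1. f x \<in> cball 0 r}"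
    have "compactin (top_of_set (ball 0 1)) (cball (0 :: complex ^ 'm) r)"
      using r by (auto simp: compactin_subtopology)
    then have "compactin (top_of_set (ball 0 1)) C"
      using compactin_proper_map_preimage proper
      unfolding proper_ball_map_def C_def by fastforce
    then have "closed C" by (simp add: compactin_subtopology compact_imp_closed)
    moreover have "closed (cball 0 1 \<inter> (\<lambda>x. norm (f x)) -` {r..})"
      by (intro continuous_closed_preimage continuous_on_norm cont) auto
    ultimately have "closure (ball 0 1) \<subseteq> C \<union> (cball 0 1 \<inter> (\<lambda>x. norm (f x)) -` {r..})"
      by (intro closure_minimal closed_Un) (auto simp: C_def)
    then have "z \<in> C \<or> r \<le> norm (f z)" using z by (auto simp: closure subset_iff)
    with r z show False by (auto simp: C_def)
  qed
  ultimately show ?thesis by simp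
qed

lemma zeros_subset_S_set:
  fixes p :: "('n::finite) cpoly ^ ('m::finite)"
  assumes q: "\<And>z. z \<in> cball 0 1 \<Longrightarrow> peval q z \<noteq> 0"
    and proper: "proper_ball_map (rat_map p q)"
  shows "{z \<in> ball 0 1. rat_map p q z = 0} \<subseteq> S_set q"
proof clarify
  fix a assume a: "a \<in> ball 0 1" and zero: "rat_map p q a = 0"
  have rat_eq: "rat_map p q x = inverse (peval q x) *s poly_map p x" for x
    by (simp add: rat_map_def poly_map_def vec_eq_iff field_simps)
  have "continuous_on (cball 0 1) (rat_map p q)"
    unfolding rat_map_def using q by (intro continuous_intros) auto
  then have "norm (rat_map p q x) = 1" if "norm x = 1" for x
    using proper that by (rule proper_norm_eq_on_sphere)
  then have sphere: "norm (poly_map p x) = cmod (peval q x)" if "norm x = 1" for x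
    using that q[of x] by (simp add: rat_eq norm_complex_scale norm_inverse norm_divide field_simps)
  have "poly_map p a = 0" "peval q a \<noteq> 0"
    using zero q[of a] a by (auto simp: rat_map_def poly_map_def vec_eq_iff)
  then have "peval q w = 0" if "hermitian w a = 1" for w
    using sphere_identity_polarized[OF sphere that] by (simp add: hermitian_def)
  then show "a \<in> S_set q" by (simp add: S_set_iff_hyperplane)
qed

theorem theorem4:
  shows "(\<forall>q :: ('n::finite) cpoly. (\<forall>z\<in>cball 0 1. peval q z \<noteq> 0) \<longrightarrow>
            finite (S_set q) \<and>
            (\<forall>p :: 'n cpoly ^ ('m::finite).
               holomorphic_map_on (rat_map p q) (ball 0 1) \<and>
               proper_ball_map (rat_map p q) \<and>
               lowest_terms p q \<longrightarrow>
               {z \<in> ball 0 1. rat_map p q z = 0} \<subseteq> S_set q))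
       \<and> S_set (1 :: 'n cpoly) = {0}
       \<and> (\<forall>p :: 'n cpoly ^ 'm. proper_ball_map (poly_map p) \<longrightarrow>
            {z \<in> ball 0 1. poly_map p z = 0} = {} \<or>
            {z \<in> ball 0 1. poly_map p z = 0} = {0})"
proof (intro conjI allI impI)
  fix q :: "'n cpoly" assume q: "\<forall>z\<in>cball 0 1. peval q z \<noteq> 0"
  then show "finite (S_set q)" by (intro finite_S_set) auto
  fix p :: "'n cpoly ^ 'm"
  assume "holomorphic_map_on (rat_map p q) (ball 0 1) \<and>
    proper_ball_map (rat_map p q) \<and> lowest_terms p q"
  with q show "{z \<in> ball 0 1. rat_map p q z = 0} \<subseteq> S_set q"
    by (intro zeros_subset_S_set) auto
next
  show "S_set (1 :: 'n cpoly) = {0}" by (rule S_set_1)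
next
  fix p :: "'n cpoly ^ 'm" assume proper: "proper_ball_map (poly_map p)"
  have "poly_map p = rat_map p 1"
    by (simp add: fun_eq_iff poly_map_def rat_map_def)
  with proper have "{z \<in> ball 0 1. poly_map p z = 0} \<subseteq> S_set 1"
    using zeros_subset_S_set[of 1 p] by simp
  then show "{z \<in> ball 0 1. poly_map p z = 0} = {} \<or> {z \<in> ball 0 1. poly_map p z = 0} = {0}"
    by (auto simp: S_set_1)
qed

end
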